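(* Let $P_\infty\square P_\infty$ be the infinite 2-dimensional grid. Then $\operatorname{gp}(P_\infty\square P_\infty)=4$.
   Context: $P_\infty$ is the two-way infinite path with vertices $v_i$, $i\in\mathbb{Z}$, where $v_i$ and $v_j$ are adjacent iff $|i-j|=1$. The Cartesian product $G\square H$ has vertex set $V(G)\times V(H)$, with $(g,h)$ and $(g',h')$ adjacent if either $g=g'$ and $hh'\in E(H)$, or $h=h'$ and $gg'\in E(G)$. A geodesic of a graph is a shortest path. A set $S$ of vertices of a graph $G$ is a general position set if no three distinct vertices of $S$ lie on a common geodesic of $G$. The general position number $\operatorname{gp}(G)$ is the maximum cardinality of a general position set of $G$. *)

theory Defs
  imports "Graph_Theory.Graph_Theory" "HOL-Library.Extended_Nat"
begin

text \<open>
  Undirected simple graphs are represented, as usual in Graph_Theory, by symmetric loop-free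
  digraphs: each undirected edge contributes both ordered pairs. The finite locale
  \<^locale>\<open>pair_graph\<close> does not apply to the infinite graphs below; the relevant locale is
  \<^locale>\<open>pair_bidirected_digraph\<close>.
\<close>

definition infinite_path :: "int pair_pre_digraph" (\<open>P\<^sub>\<infinity>\<close>) where
  "P\<^sub>\<infinity> = \<lparr> pverts = UNIV, parcs = {(i, j). \<bar>i - j\<bar> = 1} \<rparr>"

definition cartesian_product ::
    "'a pair_pre_digraph \<Rightarrow> 'b pair_pre_digraph \<Rightarrow> ('a \<times> 'b) pair_pre_digraph"  (infixr \<open>\<box>\<close> 70) where
  "G \<box> H = \<lparr> pverts = pverts G \<times> pverts H,
             parcs = {((g, h), (g', h')).
               g \<in> pverts G \<and> g = g' \<and> (h, h') \<in> parcs H \<or>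
               h \<in> pverts H \<and> h = h' \<and> (g, g') \<in> parcs G} \<rparr>"

text \<open>
  A path is the list of its vertices, in order; a geodesic is one of minimum length among all
  paths with the same end vertices.
\<close>

definition geodesic :: "('a, 'b) pre_digraph \<Rightarrow> 'a vwalk \<Rightarrow> bool" where
  "geodesic G p \<longleftrightarrow> vpath p G \<and>
     (\<forall>q. vpath q G \<and> hd q = hd p \<and> last q = last p \<longrightarrow> vwalk_length p \<le> vwalk_length q)"

definition general_position_set :: "('a, 'b) pre_digraph \<Rightarrow> 'a set \<Rightarrow> bool" where
  "general_position_set G S \<longleftrightarrow> S \<subseteq> verts G \<and>
     \<not> (\<exists>x\<in>S. \<exists>y\<in>S. \<exists>z\<in>S. x \<noteq> y \<and> y \<noteq> z \<and> x \<noteq> z \<and>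
          (\<exists>p. geodesic G p \<and> {x, y, z} \<subseteq> set p))"

text \<open>
  The value is an extended natural number because general position sets of an infinite graph may
  be infinite or of unbounded size. A finite supremum of extended natural numbers is attained, so
  a finite value is the maximum cardinality. The case distinction is needed since
  \<^const>\<open>card\<close> is 0 on infinite sets.
\<close>

definition gp :: "('a, 'b) pre_digraph \<Rightarrow> enat" where
  "gp G = (SUP S \<in> {S. general_position_set G S}. if finite S then enat (card S) else \<infinity>)"

lemma pair_bidirected_digraph_infinite_path: "pair_bidirected_digraph P\<^sub>\<infinity>"
  by unfold_locales (auto simp: infinite_path_def symmetric_def sym_def)

lemma pair_bidirected_digraph_cartesian_product:
  assumes "pair_bidirected_digraph G" "pair_bidirected_digraph H"
  shows "pair_bidirected_digraph (G \<box> H)"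
proof -
  interpret G: pair_bidirected_digraph G by fact
  interpret H: pair_bidirected_digraph H by fact
  show ?thesis
    using G.pair_sym_arcs H.pair_sym_arcs G.pair_no_loops H.pair_no_loops
    by unfold_locales
      (auto simp: cartesian_product_def symmetric_def sym_def
            dest: G.in_arcsD1 G.in_arcsD2 H.in_arcsD1 H.in_arcsD2)
qed

end

theory Submission
  imports Defs
begin

text \<open>
  Distance in the grid is the taxicab distance, and three vertices lie on a common geodesic exactly
  when the distances between them add up for some order of the three. One direction holds because
  a geodesic is isometric (\<open>grid_walk_tight\<close>), the other because shortest walks between
  consecutive vertices concatenate to a geodesic (\<open>geodesic_through\<close>). In coordinates, the
  distances add up when the middle vertex lies in the box spanned by the other two.

  The four neighbours of a vertex are in general position: none lies in the box spanned by two
  others. Conversely, of any five vertices one, say \<open>p\<close>, is different from a chosen leftmost,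
  rightmost, topmost and bottommost one. If \<open>p\<close> is neither in the box of the horizontal extremes
  nor in that of the vertical ones, it is above (or below) both horizontal extremes and to the
  right (or left) of both vertical extremes. In the case of above and right, \<open>p\<close> lies in the box of
  the topmost and the rightmost vertex; the other cases are reflections of this one
  (\<open>five_points_between\<close>).
\<close>

section \<open>Distance and walks in the grid\<close>

abbreviation grid :: "(int \<times> int, (int \<times> int) \<times> int \<times> int) pre_digraph" where
  "grid \<equiv> with_proj (P\<^sub>\<infinity> \<box> P\<^sub>\<infinity>)"

definition taxicab :: "int \<times> int \<Rightarrow> int \<times> int \<Rightarrow> nat" where
  "taxicab u v = nat (\<bar>fst u - fst v\<bar> + \<bar>snd u - snd v\<bar>)"

definition between :: "int \<times> int \<Rightarrow> int \<times> int \<Rightarrow> int \<times> int \<Rightarrow> bool" where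
  "between a b c \<longleftrightarrow> taxicab a b + taxicab b c = taxicab a c"

lemma verts_grid [simp]: "verts grid = UNIV"
  by (simp add: cartesian_product_def infinite_path_def)

lemma arcs_ends_grid_iff: "(u, v) \<in> arcs_ends grid \<longleftrightarrow> taxicab u v = 1"
  by (cases u; cases v)
    (auto simp: cartesian_product_def infinite_path_def taxicab_def)

lemma taxicab_self [simp]: "taxicab u u = 0"
  by (simp add: taxicab_def)

lemma taxicab_eq_0_iff: "taxicab u v = 0 \<longleftrightarrow> u = v"
  by (auto simp: taxicab_def prod_eq_iff)

lemma int_taxicab: "int (taxicab u v) = \<bar>fst u - fst v\<bar> + \<bar>snd u - snd v\<bar>"
  by (simp add: taxicab_def)

lemma taxicab_triangle: "taxicab u w \<le> taxicab u v + taxicab v w"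
proof -
  have "int (taxicab u w) \<le> int (taxicab u v) + int (taxicab v w)"
    unfolding int_taxicab
    using abs_triangle_ineq[of "fst u - fst v" "fst v - fst w"]
      abs_triangle_ineq[of "snd u - snd v" "snd v - snd w"] by simp
  then show ?thesis by linarith
qed

lemma between_commute: "between a b c \<longleftrightarrow> between c b a"
  unfolding between_def taxicab_def by (simp add: abs_minus_commute add.commute)

lemma between_box:
  assumes "fst a \<le> fst b \<and> fst b \<le> fst c \<or> fst c \<le> fst b \<and> fst b \<le> fst a"
    and "snd a \<le> snd b \<and> snd b \<le> snd c \<or> snd c \<le> snd b \<and> snd b \<le> snd a"
  shows "between a b c"
proof -
  have "\<bar>fst a - fst c\<bar> = \<bar>fst a - fst b\<bar> + \<bar>fst b - fst c\<bar>"
    using assms(1) by auto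
  moreover have "\<bar>snd a - snd c\<bar> = \<bar>snd a - snd b\<bar> + \<bar>snd b - snd c\<bar>"
    using assms(2) by auto
  ultimately have "int (taxicab a b) + int (taxicab b c) = int (taxicab a c)"
    unfolding int_taxicab by simp
  then show ?thesis
    unfolding between_def by linarith
qed

lemma nth_vwalk_arcs:
  "Suc i < length p \<Longrightarrow> (p ! i, p ! Suc i) \<in> set (vwalk_arcs p)"
proof (induction p arbitrary: i rule: vwalk_arcs.induct)
  case (3 x y xs)
  then show ?case by (cases i) auto
qed auto

lemma grid_walk_nth_dist:
  assumes "vwalk p grid" "i \<le> j" "j < length p"
  shows "taxicab (p ! i) (p ! j) \<le> j - i"
  using assms(2,3)
proof (induction j rule: dec_induct)
  case base
  then show ?case by simp
next
  case (step n)
  have "(p ! n, p ! Suc n) \<in> arcs_ends grid"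
    using nth_vwalk_arcs[OF step.prems] assms(1) by (auto simp: vwalk_def)
  then have "taxicab (p ! n) (p ! Suc n) = 1"
    by (simp only: arcs_ends_grid_iff)
  with step taxicab_triangle[of "p ! i" "p ! Suc n" "p ! n"] show ?case by simp
qed

lemma grid_walk_length:
  assumes "vwalk p grid"
  shows "taxicab (hd p) (last p) \<le> length p - 1"
proof -
  have "p \<noteq> []" using assms by (simp add: vwalk_def)
  then show ?thesis
    using grid_walk_nth_dist[OF assms, of 0 "length p - 1"]
    by (simp add: hd_conv_nth last_conv_nth)
qed

text \<open>
  By the triangle inequality, a walk that is as short as its ends permit cannot lose length on any
  of its sections.
\<close>

lemma grid_walk_tight:
  assumes "vwalk p grid" "length p - 1 = taxicab (hd p) (last p)"
    and "i \<le> j" "j < length p"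
  shows "taxicab (p ! i) (p ! j) = j - i"
proof -
  let ?m = "length p - 1"
  have "p \<noteq> []" using assms(1) by (simp add: vwalk_def)
  then have "?m = taxicab (p ! 0) (p ! ?m)"
    using assms(2) by (simp add: hd_conv_nth last_conv_nth)
  moreover have "taxicab (p ! 0) (p ! i) \<le> i" "taxicab (p ! i) (p ! j) \<le> j - i"
    "taxicab (p ! j) (p ! ?m) \<le> ?m - j"
    using grid_walk_nth_dist[OF assms(1), of 0 i] grid_walk_nth_dist[OF assms(1), of i j]
      grid_walk_nth_dist[OF assms(1), of j ?m] assms(3,4) by auto
  moreover have "taxicab (p ! 0) (p ! ?m)
      \<le> taxicab (p ! 0) (p ! i) + taxicab (p ! i) (p ! j) + taxicab (p ! j) (p ! ?m)"
    using taxicab_triangle[of "p ! 0" "p ! ?m" "p ! i"]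
      taxicab_triangle[of "p ! i" "p ! ?m" "p ! j"] by linarith
  ultimately show ?thesis using assms(3,4) by linarith
qed

section \<open>Geodesics of the grid\<close>

lemma geodesic_if_tight:
  assumes "vwalk p grid" "length p - 1 = taxicab (hd p) (last p)"
  shows "geodesic grid p"
proof -
  have "p ! i \<noteq> p ! j" if "i < j" "j < length p" for i j
    using grid_walk_tight[OF assms, of i j] that by (auto simp flip: taxicab_eq_0_iff)
  then have "distinct p"
    unfolding distinct_conv_nth by (metis linorder_neqE_nat)
  moreover have "length p - 1 \<le> length q - 1"
    if "vwalk q grid" "hd q = hd p" "last q = last p" for q
    using grid_walk_length[OF that(1)] assms(2) that(2,3) by simp
  ultimately show ?thesis
    using assms(1) by (simp add: geodesic_def vpath_def)
qed

lemma taxicab_step_towards: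
  assumes "a \<noteq> b"
  obtains a' where "taxicab a a' = 1" "taxicab a b = Suc (taxicab a' b)"
proof -
  obtain x y z w where [simp]: "a = (x, y)" "b = (z, w)" by fastforce
  consider "x < z" | "z < x" | "x = z" "y < w" | "x = z" "w < y"
    using assms by force
  then show thesis
  proof cases
    case 1 then show ?thesis by (intro that[of "(x + 1, y)"]) (auto simp: taxicab_def)
  next
    case 2 then show ?thesis by (intro that[of "(x - 1, y)"]) (auto simp: taxicab_def)
  next
    case 3 then show ?thesis by (intro that[of "(x, y + 1)"]) (auto simp: taxicab_def)
  next
    case 4 then show ?thesis by (intro that[of "(x, y - 1)"]) (auto simp: taxicab_def)
  qed
qed

text \<open>
  Prolonging a given walk, rather than joining two ends by a new one, yields walks through any
  number of prescribed vertices by repeated use.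
\<close>

lemma grid_walk_extend:
  assumes "vwalk w grid"
  shows "\<exists>us. vwalk (us @ w) grid \<and> hd (us @ w) = a \<and> length us = taxicab a (hd w)"
proof (induction "taxicab a (hd w)" arbitrary: a)
  case 0
  then have "a = hd w" by (simp flip: taxicab_eq_0_iff)
  then show ?case using assms by (intro exI[of _ "[]"]) simp
next
  case (Suc n)
  then have "a \<noteq> hd w" by auto
  then obtain a' where a': "taxicab a a' = 1" "taxicab a (hd w) = Suc (taxicab a' (hd w))"
    by (rule taxicab_step_towards)
  then obtain us where us: "vwalk (us @ w) grid" "hd (us @ w) = a'"
      "length us = taxicab a' (hd w)"
    using Suc.hyps(1)[of a'] Suc.hyps(2) by auto
  have "vwalk (a # us @ w) grid"
    using us(1,2) a'(1) by (intro vwalk_consI) (simp_all only: verts_grid arcs_ends_grid_iff UNIV_I)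
  then show ?case using us a' by (intro exI[of _ "a # us"]) simp
qed

lemma geodesic_through:
  assumes "between a b c"
  obtains p where "geodesic grid p" "{a, b, c} \<subseteq> set p"
proof -
  have "vwalk [c] grid" by (auto simp: vwalk_def simp del: with_proj_simps)
  then obtain us where us: "vwalk (us @ [c]) grid" "hd (us @ [c]) = b" "length us = taxicab b c"
    using grid_walk_extend[of "[c]" b] by auto
  then obtain ts where ts: "vwalk (ts @ us @ [c]) grid" "hd (ts @ us @ [c]) = a"
      "length ts = taxicab a b"
    using grid_walk_extend[of "us @ [c]" a] by auto
  let ?p = "ts @ us @ [c]"
  have "a \<in> set ?p" "b \<in> set (us @ [c])"
    using ts(2) us(2) hd_in_set[of ?p] hd_in_set[of "us @ [c]"] by auto
  moreover have "geodesic grid ?p"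
    using ts us(3) assms by (intro geodesic_if_tight) (auto simp: between_def)
  ultimately show thesis by (intro that[of ?p]) auto
qed

lemma geodesic_tight:
  assumes "geodesic grid p"
  shows "length p - 1 = taxicab (hd p) (last p)"
proof -
  have walk: "vwalk p grid" using assms by (simp add: geodesic_def vpath_def)
  have "vwalk [last p] grid" by (auto simp: vwalk_def simp del: with_proj_simps)
  then obtain us where us: "vwalk (us @ [last p]) grid" "hd (us @ [last p]) = hd p"
      "length us = taxicab (hd p) (last p)"
    using grid_walk_extend[of "[last p]" "hd p"] by auto
  then have "vpath (us @ [last p]) grid"
    using geodesic_if_tight[of "us @ [last p]"] by (simp add: geodesic_def)
  then have "length p - 1 \<le> taxicab (hd p) (last p)"
    using assms us(2,3) unfolding geodesic_def by (metis last_snoc length_append_singleton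
      diff_Suc_1 vwalk_length_simp)
  then show ?thesis using grid_walk_length[OF walk] by simp
qed

text \<open>
  The order in which the geodesic visits the three vertices decides which of them is in the
  middle.
\<close>

lemma geodesic_imp_between:
  assumes "geodesic grid p" "{x, y, z} \<subseteq> set p"
  shows "between x y z \<or> between y x z \<or> between x z y"
proof -
  have walk: "vwalk p grid" using assms(1) by (simp add: geodesic_def vpath_def)
  have ordered: "between (p ! i) (p ! j) (p ! k)" if "i \<le> j" "j \<le> k" "k < length p" for i j k
    using that grid_walk_tight[OF walk geodesic_tight[OF assms(1)]] by (simp add: between_def)
  obtain i j k where ijk: "x = p ! i" "y = p ! j" "z = p ! k"
      "i < length p" "j < length p" "k < length p"
    using assms(2) by (auto simp: in_set_conv_nth)
  consider "i \<le> j \<and> j \<le> k" | "k \<le> j \<and> j \<le> i" | "j \<le> i \<and> i \<le> k" | "k \<le> i \<and> i \<le> j"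
    | "i \<le> k \<and> k \<le> j" | "j \<le> k \<and> k \<le> i"
    by linarith
  then show ?thesis
    using ordered ijk by cases (metis between_commute)+
qed

section \<open>General position sets of the grid\<close>

lemma finite_extremes:
  fixes f :: "'a \<Rightarrow> 'b :: linorder"
  assumes "finite S" "S \<noteq> {}"
  obtains l u where "l \<in> S" "u \<in> S" "\<And>s. s \<in> S \<Longrightarrow> f l \<le> f s" "\<And>s. s \<in> S \<Longrightarrow> f s \<le> f u"
proof -
  have "Min (f ` S) \<in> f ` S" "Max (f ` S) \<in> f ` S"
    using assms by simp_all
  then obtain l u where "l \<in> S" "f l = Min (f ` S)" "u \<in> S" "f u = Max (f ` S)"
    by (metis imageE)
  then show thesis using assms(1) by (intro that[of l u]) simp_all
qed

lemma five_points_between: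
  assumes "finite S" "4 < card S"
  obtains x y z where "x \<in> S" "y \<in> S" "z \<in> S" "x \<noteq> y" "y \<noteq> z" "x \<noteq> z" "between x y z"
proof -
  note witnesses = that
  have "S \<noteq> {}" using assms(2) by auto
  obtain l r where lr: "l \<in> S" "r \<in> S"
      "\<And>s. s \<in> S \<Longrightarrow> fst l \<le> fst s" "\<And>s. s \<in> S \<Longrightarrow> fst s \<le> fst r"
    using finite_extremes[OF assms(1) \<open>S \<noteq> {}\<close>, of fst] by metis
  obtain b t where bt: "b \<in> S" "t \<in> S"
      "\<And>s. s \<in> S \<Longrightarrow> snd b \<le> snd s" "\<And>s. s \<in> S \<Longrightarrow> snd s \<le> snd t"
    using finite_extremes[OF assms(1) \<open>S \<noteq> {}\<close>, of snd] by metis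
  have "card {l, r, b, t} \<le> 4"
    by (simp add: card_insert_if)
  then have "\<not> S \<subseteq> {l, r, b, t}"
    using assms(2) card_mono[of "{l, r, b, t}" S] by fastforce
  then obtain p where p: "p \<in> S" "p \<noteq> l" "p \<noteq> r" "p \<noteq> b" "p \<noteq> t" by auto
  have bounds: "fst l \<le> fst p" "fst p \<le> fst r" "snd b \<le> snd p" "snd p \<le> snd t"
    using lr bt p by auto
  have found: thesis if "x \<in> {l, r, b, t}" "z \<in> {l, r, b, t}" "x \<noteq> z" "between x p z" for x z
    using that lr bt p by (intro witnesses[of x p z]) auto
  show thesis
  proof (cases "between l p r \<and> l \<noteq> r \<or> between b p t \<and> b \<noteq> t")
    case True
    then show thesis using found[of l r] found[of b t] by auto
  next
    case False
    \<comment> \<open>If the two horizontal extremes coincide then \<open>S\<close> lies on a vertical line, and \<open>p\<close> would be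
      between its two ends; similarly for the vertical extremes.\<close>
    have "l \<noteq> r"
    proof
      assume "l = r"
      then have eq: "fst s = fst p" if "s \<in> S" for s
        using lr(3,4)[OF that] bounds by simp
      then have "between b p t" using bt(1,2) bounds by (intro between_box) simp_all
      moreover have "b \<noteq> t"
        using eq[OF bt(1)] bounds(3,4) p(4) by (metis antisym prod_eqI)
      ultimately show False using False by simp
    qed
    have "b \<noteq> t"
    proof
      assume "b = t"
      then have eq: "snd s = snd p" if "s \<in> S" for s
        using bt(3,4)[OF that] bounds by simp
      then have "between l p r" using lr(1,2) bounds by (intro between_box) simp_all
      then show False using False \<open>l \<noteq> r\<close> by simp
    qed
    have "\<not> between l p r" "\<not> between b p t"
      using False \<open>l \<noteq> r\<close> \<open>b \<noteq> t\<close> by auto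
    then have "snd l < snd p \<and> snd r < snd p \<or> snd p < snd l \<and> snd p < snd r"
      "fst b < fst p \<and> fst t < fst p \<or> fst p < fst b \<and> fst p < fst t"
      using between_box[of l p r] between_box[of b p t] bounds by linarith+
    then consider
        "snd r < snd p" "fst t < fst p" | "snd l < snd p" "fst p < fst t"
      | "snd p < snd r" "fst b < fst p" | "snd p < snd l" "fst p < fst b"
      by blast
    then show thesis
    proof cases
      case 1
      then have "between t p r" "t \<noteq> r" using bounds by (auto intro: between_box)
      then show thesis by (intro found[of t r]) auto
    next
      case 2
      then have "between t p l" "t \<noteq> l" using bounds by (auto intro: between_box)
      then show thesis by (intro found[of t l]) auto
    next
      case 3
      then have "between b p r" "b \<noteq> r" using bounds by (auto intro: between_box)
      then show thesis by (intro found[of b r]) auto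
    next
      case 4
      then have "between b p l" "b \<noteq> l" using bounds by (auto intro: between_box)
      then show thesis by (intro found[of b l]) auto
    qed
  qed
qed

lemma general_position_set_grid_iff:
  "general_position_set grid S \<longleftrightarrow>
    (\<forall>x\<in>S. \<forall>y\<in>S. \<forall>z\<in>S. x \<noteq> y \<longrightarrow> y \<noteq> z \<longrightarrow> x \<noteq> z \<longrightarrow> \<not> between x y z)"
    (is "_ \<longleftrightarrow> ?free")
proof
  assume gps: "general_position_set grid S"
  show ?free
  proof (intro ballI impI notI)
    fix x y z assume xyz: "x \<in> S" "y \<in> S" "z \<in> S" "x \<noteq> y" "y \<noteq> z" "x \<noteq> z" "between x y z"
    obtain p where "geodesic grid p" "{x, y, z} \<subseteq> set p"
      using xyz(7) by (rule geodesic_through)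
    then have "\<exists>p. geodesic grid p \<and> {x, y, z} \<subseteq> set p" by (intro exI conjI)
    then show False using gps xyz(1-6) by (simp only: general_position_set_def) metis
  qed
next
  assume free: ?free
  have False if "x \<in> S" "y \<in> S" "z \<in> S" "x \<noteq> y" "y \<noteq> z" "x \<noteq> z"
    "geodesic grid p" "{x, y, z} \<subseteq> set p" for x y z p
    using geodesic_imp_between[OF that(7,8)] free that(1-6) by (elim disjE) metis+
  then show "general_position_set grid S"
    unfolding general_position_set_def verts_grid by blast
qed

theorem corollary3p2:
  shows "gp (with_proj (P\<^sub>\<infinity> \<box> P\<^sub>\<infinity>)) = 4"
proof (rule antisym)
  show "gp grid \<le> 4"
    unfolding gp_def
  proof (rule SUP_least)
    fix S assume "S \<in> {S. general_position_set grid S}"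
    then have free: "\<not> between x y z"
      if "x \<in> S" "y \<in> S" "z \<in> S" "x \<noteq> y" "y \<noteq> z" "x \<noteq> z" for x y z
      using that by (simp add: general_position_set_grid_iff)
    have small: "card T \<le> 4" if "T \<subseteq> S" "finite T" for T
    proof (rule ccontr)
      assume "\<not> card T \<le> 4"
      then have "4 < card T" by simp
      with that(2) obtain x y z where xyz: "x \<in> T" "y \<in> T" "z \<in> T"
          "x \<noteq> y" "y \<noteq> z" "x \<noteq> z" "between x y z"
        by (rule five_points_between)
      have "\<not> between x y z"
        using xyz(1-3)[THEN subsetD[OF that(1)]] xyz(4-6) by (rule free)
      then show False using xyz(7) by (rule notE)
    qed
    have "finite S"
    proof (rule ccontr)
      assume "infinite S"
      then obtain T where "T \<subseteq> S" "finite T" "card T = 5"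
        using infinite_arbitrarily_large by metis
      then show False using small[of T] by simp
    qed
    then show "(if finite S then enat (card S) else \<infinity>) \<le> 4"
      using small[of S] by (simp add: numeral_eq_enat)
  qed
next
  let ?S = "{(1, 0), (-1, 0), (0, 1), (0, -1)} :: (int \<times> int) set"
  have gps: "general_position_set grid ?S"
    unfolding general_position_set_grid_iff between_def taxicab_def by simp
  have "4 = (if finite ?S then enat (card ?S) else \<infinity>)"
    by (simp add: numeral_eq_enat)
  also have "\<dots> \<le> gp grid"
    unfolding gp_def using gps by (intro SUP_upper CollectI)
  finally show "4 \<le> gp grid" .
qed

end
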